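(* Let $F$ be a fundamental diagram as in the context, with maximum $\sigma=F(\rho^\star)$. Consider a junction with one incoming road (road $1$) and two outgoing roads (roads $2$ and $3$), with the kinetic coupling conditions for drivers without preferences. Let $\rho_B^1,\rho_B^2,\rho_B^3\in[0,1]$ be given. Then the matching problem at the junction (defined in the context) determines the macroscopic fluxes at the junction: it has a solution, and for every solution the fluxes $C^1,C^2,C^3$ (which satisfy $C^1=C^2+C^3$) are given as follows. Case 1 (RP1-1-1): $\rho_B^1\ge\rho^\star$, $\rho_B^2\le\rho^\star$, $\rho_B^3\le\rho^\star$. Then $C^1=\sigma$ and $C^2=C^3=\frac{\sigma}{2}$. Case 2 (RP1-1-2): $\rho_B^1\ge\rho^\star$, $\rho_B^2\le\rho^\star$, $\rho_B^3\ge\rho^\star$. - If $2F(\rho_B^3)\le\sigma$: $C^1=\sigma$, $C^3=F(\rho_B^3)$. - If $2F(\rho_B^3)\ge\sigma$: $C^1=\sigma$, $C^2=C^3=\frac{\sigma}{2}$. Case 3 (RP1-2-1): $\rho_B^1\ge\rho^\star$, $\rho_B^2\ge\rho^\star$, $\rho_B^3\le\rho^\star$. - If $2F(\rho_B^2)\ge\sigma$: $C^1=\sigma$, $C^2=C^3=\frac{\sigma}{2}$. - If $2F(\rho_B^2)\le\sigma$: $C^1=\sigma$, $C^2=F(\rho_B^2)$. Case 4 (RP2-1-1): $\rho_B^1\le\rho^\star$, $\rho_B^2\le\rho^\star$, $\rho_B^3\le\rho^\star$. Then $C^1=F(\rho_B^1)$ and $C^2=C^3=\frac{F(\rho_B^1)}{2}$.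 Case 5 (RP1-2-2): $\rho_B^1\ge\rho^\star$, $\rho_B^2\ge\rho^\star$, $\rho_B^3\ge\rho^\star$. - If $F(\rho_B^2)+F(\rho_B^3)\le\sigma$: $C^2=F(\rho_B^2)$, $C^3=F(\rho_B^3)$. - If $F(\rho_B^2)\ge\frac{\sigma}{2}$ and $F(\rho_B^3)\ge\frac{\sigma}{2}$: $C^1=\sigma$, $C^2=\frac{\sigma}{2}$, $C^3=\frac{\sigma}{2}$. - If $F(\rho_B^2)+F(\rho_B^3)\ge\sigma$ and $F(\rho_B^3)\le\frac{\sigma}{2}$: $C^1=\sigma$, $C^2=\sigma-F(\rho_B^3)$, $C^3=F(\rho_B^3)$. - If $F(\rho_B^2)+F(\rho_B^3)\ge\sigma$ and $F(\rho_B^2)\le\frac{\sigma}{2}$: $C^1=\sigma$, $C^2=F(\rho_B^2)$, $C^3=\sigma-F(\rho_B^2)$. Case 6 (RP2-1-2): $\rho_B^1\le\rho^\star$, $\rho_B^2\le\rho^\star$, $\rho_B^3\ge\rho^\star$. - If $F(\rho_B^1)\le 2F(\rho_B^3)$: $C^1=F(\rho_B^1)$, $C^2=C^3=\frac{F(\rho_B^1)}{2}$. - If $2F(\rho_B^3)\le F(\rho_B^1)$: $C^1=F(\rho_B^1)$, $C^3=F(\rho_B^3)$, $C^2=F(\rho_B^1)-F(\rho_B^3)$. Case 7 (RP2-2-1): $\rho_B^1\le\rho^\star$, $\rho_B^2\ge\rho^\star$, $\rho_B^3\le\rho^\star$. - If $F(\rho_B^1)\le 2F(\rho_B^2)$: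 $C^1=F(\rho_B^1)$, $C^2=C^3=\frac{F(\rho_B^1)}{2}$. - If $2F(\rho_B^2)\le F(\rho_B^1)$: $C^1=F(\rho_B^1)$, $C^2=F(\rho_B^2)$, $C^3=F(\rho_B^1)-F(\rho_B^2)$. Case 8 (RP2-2-2): $\rho_B^1\le\rho^\star$, $\rho_B^2\ge\rho^\star$, $\rho_B^3\ge\rho^\star$. - If $F(\rho_B^2)+F(\rho_B^3)\le F(\rho_B^1)$: $C^1=F(\rho_B^2)+F(\rho_B^3)$, $C^2=F(\rho_B^2)$, $C^3=F(\rho_B^3)$. - If $\frac{F(\rho_B^1)}{2}\le\min(F(\rho_B^2),F(\rho_B^3))$: $C^1=F(\rho_B^1)$, $C^2=C^3=\frac{F(\rho_B^1)}{2}$. - If $F(\rho_B^2)+F(\rho_B^3)\ge F(\rho_B^1)$ and $2F(\rho_B^3)\le F(\rho_B^1)$: $C^1=F(\rho_B^1)$, $C^2=F(\rho_B^1)-F(\rho_B^3)$, $C^3=F(\rho_B^3)$. - If $F(\rho_B^2)+F(\rho_B^3)\ge F(\rho_B^1)$ and $2F(\rho_B^2)\le F(\rho_B^1)$: $C^1=F(\rho_B^1)$, $C^2=F(\rho_B^2)$, $C^3=F(\rho_B^1)-F(\rho_B^2)$.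
   Context: **Fundamental diagram.** $F:[0,1]\to[0,1]$ is smooth and strictly concave, with $F(0)=F(1)=0$, $F'(\rho)\le 1$ and $0\le F(\rho)\le\rho$ on $[0,1]$. Its unique maximum point is $\rho^\star\in(0,1)$ and $\sigma=F(\rho^\star)$. For $0\le C\le\sigma$, let $\rho_-(C)\in[0,\rho^\star]$ and $\rho_+(C)\in[\rho^\star,1]$ be the solutions of $F(\rho)=C$ in these intervals (so $\rho_\pm(\sigma)=\rho^\star$, $\rho_-(0)=0$, $\rho_+(0)=1$). For $\rho\in[0,1]\setminus\{\rho^\star\}$, $\tau(\rho)\ne\rho$ is defined by $F(\tau(\rho))=F(\rho)$, and $\tau(\rho^\star)=\rho^\star$. **Origin of the problem.** The kinetic two-velocity traffic model is $$\partial_t\rho+\partial_x q=0,\qquad \partial_t q+\tfrac{q}{1-\rho}\partial_x\rho+\bigl(1-\tfrac{q}{1-\rho}\bigr)\partial_x q=-\tfrac1\epsilon\,(q-F(\rho)),$$ whose limit as $\epsilon\to0$ is the scalar law $\partial_t\rho+\partial_xF(\rho)=0$. Rescaling space by $\epsilon$ near the junction gives on each road a layer with constant flux $q=C$ and with $\pm\partial_y\rho=(1-\rho)\frac{F(\rho)-C}{C}$, $y\in[0,\infty)$ (sign $+$ for outgoing roads, whose left end is at the junction; sign $-$ for the incoming road, whose right end is at the junction). Here $\rho_0$ denotes the layer value at $y=0$ (at the junction) and $\rho_K$ its value at $y=\infty$. The limit coupling conditions are obtained by matching the coupled layers with half-Riemann problems for the scalar law. This is made precise as follows. **Matching problem at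 the junction.** Given $\rho_B^1,\rho_B^2,\rho_B^3\in[0,1]$, find $C^i\in[0,\sigma]$, $\rho_K^i\in[0,1]$, $\rho_0^i\in[0,1]$, $i=1,2,3$, satisfying (a), (b), (c). (a) *Layer conditions.* For each outgoing road ($i=2,3$), the triple $(C,\rho_K,\rho_0)=(C^i,\rho_K^i,\rho_0^i)$ satisfies one of: - (U) $0\le C<\sigma$, $\rho_K=\rho_-(C)$, $\rho_0=\rho_-(C)$; - (S) $0<C<\sigma$, $\rho_K=\rho_+(C)$, $\rho_0\in(\rho_-(C),1)$; or $C=\sigma$, $\rho_K=\rho^\star$, $\rho_0\in[\rho^\star,1)$; or $C=0$, $\rho_K=1$, $\rho_0\in(0,1]$. For the incoming road ($i=1$), the triple $(C,\rho_K,\rho_0)=(C^1,\rho_K^1,\rho_0^1)$ satisfies one of: - (U) $0\le C<\sigma$, $\rho_K=\rho_+(C)$, $\rho_0=\rho_+(C)$; - (S) $0<C<\sigma$, $\rho_K=\rho_-(C)$, $\rho_0\in[0,\rho_+(C))$; or $C=\sigma$, $\rho_K=\rho^\star$, $\rho_0\in[0,\rho^\star]$; or $C=0$, $\rho_K=0$, $\rho_0\in[0,1)$. (b) *Half-Riemann conditions* (the waves connecting $\rho_K^i$ and $\rho_B^i$ move into the road). - Outgoing roads $i=2,3$: if $\rho_B^i\le\rho^\star$ (RP1), then $\rho_K^i\in[0,\rho^\star]$; if $\rho_B^i>\rho^\star$ (RP2), then $\rho_K^i\in[0,\tau(\rho_B^i)]\cup\{\rho_B^i\}$. - Incoming road $i=1$: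 if $\rho_B^1\ge\rho^\star$ (RP1), then $\rho_K^1\in[\rho^\star,1]$; if $\rho_B^1<\rho^\star$ (RP2), then $\rho_K^1\in\{\rho_B^1\}\cup[\tau(\rho_B^1),1]$. The notation RP$a$-$b$-$c$ indicates the types of the half-Riemann problems on roads $1,2,3$. (c) *Kinetic coupling conditions without driver preferences*, applied at the junction with $\rho^i=\rho_0^i$ and $q^i=C^i$: the balance of fluxes $q^1=q^2+q^3$ holds, together with at least one of - (I) $\rho^1=\rho^2=\rho^3\ge q^1$; - (II) $\rho^2=\rho^3\le q^1=\rho^1$; - (III) $q^1\le\rho^1=\rho^3\le\rho^2$ and $q^2=0$; - (IV) $q^1\le\rho^1=\rho^2\le\rho^3$ and $q^3=0$. *)

theory Defs
  imports Complex_Main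
begin

definition strictly_concave_on :: "real set \<Rightarrow> (real \<Rightarrow> real) \<Rightarrow> bool" where
  "strictly_concave_on S f \<longleftrightarrow>
     (\<forall>x\<in>S. \<forall>y\<in>S. x \<noteq> y \<longrightarrow>
        (\<forall>t. 0 < t \<and> t < 1 \<longrightarrow> (1 - t) * f x + t * f y < f ((1 - t) * x + t * y)))"

text \<open>
  Infinitely differentiable on a set: there is a chain of successive derivatives of all orders.
  The derivatives are taken within \<open>S\<close>, so they are one-sided at the end points of an interval.
\<close>
definition smooth_on :: "real set \<Rightarrow> (real \<Rightarrow> real) \<Rightarrow> bool" where
  "smooth_on S f \<longleftrightarrow>
     (\<exists>D :: nat \<Rightarrow> real \<Rightarrow> real. (\<forall>x\<in>S. D 0 x = f x) \<and>
        (\<forall>n. \<forall>x\<in>S. (D n has_real_derivative D (Suc n) x) (at x within S)))"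

text \<open>The values of \<open>F\<close> outside \<open>[0,1]\<close> are irrelevant.\<close>
definition fundamental_diagram :: "(real \<Rightarrow> real) \<Rightarrow> real \<Rightarrow> bool" where
  "fundamental_diagram F rstar \<longleftrightarrow>
     (\<forall>\<rho>\<in>{0..1}. F \<rho> \<in> {0..1}) \<and>
     smooth_on {0..1} F \<and>
     strictly_concave_on {0..1} F \<and>
     F 0 = 0 \<and> F 1 = 0 \<and>
     (\<forall>\<rho>\<in>{0..1}. \<exists>d\<le>1. (F has_real_derivative d) (at \<rho> within {0..1})) \<and>
     (\<forall>\<rho>\<in>{0..1}. 0 \<le> F \<rho> \<and> F \<rho> \<le> \<rho>) \<and>
     rstar \<in> {0<..<1} \<and>
     (\<forall>\<rho>\<in>{0..1}. \<rho> \<noteq> rstar \<longrightarrow> F \<rho> < F rstar)"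

definition rho_minus :: "(real \<Rightarrow> real) \<Rightarrow> real \<Rightarrow> real \<Rightarrow> real" where
  "rho_minus F rstar C = (THE \<rho>. \<rho> \<in> {0..rstar} \<and> F \<rho> = C)"

definition rho_plus :: "(real \<Rightarrow> real) \<Rightarrow> real \<Rightarrow> real \<Rightarrow> real" where
  "rho_plus F rstar C = (THE \<rho>. \<rho> \<in> {rstar..1} \<and> F \<rho> = C)"

definition tau :: "(real \<Rightarrow> real) \<Rightarrow> real \<Rightarrow> real \<Rightarrow> real" where
  "tau F rstar \<rho> =
     (if \<rho> = rstar then rstar else (THE r. r \<in> {0..1} \<and> r \<noteq> \<rho> \<and> F r = F \<rho>))"

text \<open>
  Layer conditions, in terms of the flux \<open>C\<close>, the layer value \<open>rK\<close> at infinity and the layer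
  value \<open>r0\<close> at the junction. In each definition the first disjunct is the unstable case (U) and
  the other three form the stable case (S).
\<close>
definition layer_outgoing :: "(real \<Rightarrow> real) \<Rightarrow> real \<Rightarrow> real \<Rightarrow> real \<Rightarrow> real \<Rightarrow> bool" where
  "layer_outgoing F rstar C rK r0 \<longleftrightarrow>
     (0 \<le> C \<and> C < F rstar \<and> rK = rho_minus F rstar C \<and> r0 = rho_minus F rstar C) \<or>
     (0 < C \<and> C < F rstar \<and> rK = rho_plus F rstar C \<and> r0 \<in> {rho_minus F rstar C<..<1}) \<or>
     (C = F rstar \<and> rK = rstar \<and> r0 \<in> {rstar..<1}) \<or>
     (C = 0 \<and> rK = 1 \<and> r0 \<in> {0<..1})"

definition layer_incoming :: "(real \<Rightarrow> real) \<Rightarrow> real \<Rightarrow> real \<Rightarrow> real \<Rightarrow> real \<Rightarrow> bool" where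
  "layer_incoming F rstar C rK r0 \<longleftrightarrow>
     (0 \<le> C \<and> C < F rstar \<and> rK = rho_plus F rstar C \<and> r0 = rho_plus F rstar C) \<or>
     (0 < C \<and> C < F rstar \<and> rK = rho_minus F rstar C \<and> r0 \<in> {0..<rho_plus F rstar C}) \<or>
     (C = F rstar \<and> rK = rstar \<and> r0 \<in> {0..rstar}) \<or>
     (C = 0 \<and> rK = 0 \<and> r0 \<in> {0..<1})"

definition half_riemann_outgoing :: "(real \<Rightarrow> real) \<Rightarrow> real \<Rightarrow> real \<Rightarrow> real \<Rightarrow> bool" where
  "half_riemann_outgoing F rstar rB rK \<longleftrightarrow>
     (rB \<le> rstar \<longrightarrow> rK \<in> {0..rstar}) \<and>
     (rB > rstar \<longrightarrow> rK \<in> {0..tau F rstar rB} \<union> {rB})"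

definition half_riemann_incoming :: "(real \<Rightarrow> real) \<Rightarrow> real \<Rightarrow> real \<Rightarrow> real \<Rightarrow> bool" where
  "half_riemann_incoming F rstar rB rK \<longleftrightarrow>
     (rB \<ge> rstar \<longrightarrow> rK \<in> {rstar..1}) \<and>
     (rB < rstar \<longrightarrow> rK \<in> {rB} \<union> {tau F rstar rB..1})"

text \<open>
  From here on, road data are functions of the road number; only the values at the roads
  \<open>1\<close> (incoming), \<open>2\<close> and \<open>3\<close> (outgoing) are used.
\<close>
definition kinetic_coupling :: "(nat \<Rightarrow> real) \<Rightarrow> (nat \<Rightarrow> real) \<Rightarrow> bool" where
  "kinetic_coupling r q \<longleftrightarrow>
     q 1 = q 2 + q 3 \<and>
     ((r 1 = r 2 \<and> r 2 = r 3 \<and> r 3 \<ge> q 1) \<or>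
      (r 2 = r 3 \<and> r 3 \<le> q 1 \<and> q 1 = r 1) \<or>
      (q 1 \<le> r 1 \<and> r 1 = r 3 \<and> r 3 \<le> r 2 \<and> q 2 = 0) \<or>
      (q 1 \<le> r 1 \<and> r 1 = r 2 \<and> r 2 \<le> r 3 \<and> q 3 = 0))"

definition matching_solution ::
  "(real \<Rightarrow> real) \<Rightarrow> real \<Rightarrow> (nat \<Rightarrow> real) \<Rightarrow> (nat \<Rightarrow> real) \<Rightarrow> (nat \<Rightarrow> real) \<Rightarrow> (nat \<Rightarrow> real) \<Rightarrow> bool"
where
  "matching_solution F rstar rB C rK r0 \<longleftrightarrow>
     (\<forall>i\<in>{1,2,3}. C i \<in> {0..F rstar} \<and> rK i \<in> {0..1} \<and> r0 i \<in> {0..1}) \<and>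
     layer_incoming F rstar (C 1) (rK 1) (r0 1) \<and>
     (\<forall>i\<in>{2,3}. layer_outgoing F rstar (C i) (rK i) (r0 i)) \<and>
     half_riemann_incoming F rstar (rB 1) (rK 1) \<and>
     (\<forall>i\<in>{2,3}. half_riemann_outgoing F rstar (rB i) (rK i)) \<and>
     kinetic_coupling r0 C"

end

theory Submission
  imports Defs
begin

text \<open>
  The layer and half-Riemann conditions say that an incoming road carries at most its demand
  \<open>d\<close> and an outgoing road at most its supply \<open>s\<close>. The junction density is tied to the flux
  (\<open>\<rho>\<^sub>+(C)\<close> on the incoming road, \<open>\<rho>\<^sub>-(C)\<close> on an outgoing one) as long as the bound is not
  attained, and only bounded by that value when it is. If \<open>C\<^sup>1 < d\<close>, the density \<open>\<rho>\<^sub>+(C\<^sup>1)\<close>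
  exceeds \<open>\<rho>\<^sup>*\<close>, and the coupling conditions propagate this to both outgoing roads, which are
  therefore saturated. If the two outgoing fluxes differ, the road with the smaller one is saturated,
  since \<open>\<rho>\<^sub>-\<close> is increasing. So \<open>C\<^sup>1 = min d (s\<^sup>2 + s\<^sup>3)\<close>, shared as equally as the
  supplies permit.
\<close>

definition road_supply :: "(real \<Rightarrow> real) \<Rightarrow> real \<Rightarrow> real \<Rightarrow> real" where
  "road_supply F rstar rB = (if rB \<le> rstar then F rstar else F rB)"

text \<open>Together with \<open>road_supply\<close>, the demand and supply functions of the Godunov
  flux for a concave \<open>F\<close>. At \<open>rB = rstar\<close> the two branches agree.\<close>

definition road_demand :: "(real \<Rightarrow> real) \<Rightarrow> real \<Rightarrow> real \<Rightarrow> real" where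
  "road_demand F rstar rB = (if rB \<ge> rstar then F rstar else F rB)"

section \<open>Monotonicity of the fundamental diagram on both sides of its maximum\<close>

locale diagram =
  fixes F :: "real \<Rightarrow> real" and rstar :: real
  assumes diagram: "fundamental_diagram F rstar"
begin

lemma rstar: "0 < rstar" "rstar < 1"
  and F_end: "F 0 = 0" "F 1 = 0"
  using diagram by (auto simp: fundamental_diagram_def)

lemma F_bounds:
  assumes "x \<in> {0..1}"
  shows "0 \<le> F x" "F x \<le> x" "F x \<le> F rstar"
  using diagram assms by (fastforce simp: fundamental_diagram_def less_eq_real_def)+

lemma F_less_max: "\<lbrakk>x \<in> {0..1}; x \<noteq> rstar\<rbrakk> \<Longrightarrow> F x < F rstar"
  using diagram by (auto simp: fundamental_diagram_def)

lemma max_flux: "0 < F rstar" "F rstar \<le> rstar"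
  using F_less_max[of 0] F_bounds[of rstar] rstar F_end by auto

text \<open>Concavity along the chord from \<open>x\<close> to the maximiser, whose values already
  exceed \<open>F x\<close>. Both monotonicity lemmas are obtained from this.\<close>

lemma F_less_between:
  assumes "x \<in> {0..1}" "x \<noteq> rstar" "0 < t" "t < 1"
  shows "F x < F ((1 - t) * x + t * rstar)"
proof -
  have "t * F x < t * F rstar"
    using F_less_max assms by simp
  then have "F x < (1 - t) * F x + t * F rstar"
    by (simp add: algebra_simps)
  also have "\<dots> < F ((1 - t) * x + t * rstar)"
    using diagram assms rstar by (auto simp: fundamental_diagram_def strictly_concave_on_def)
  finally show ?thesis .
qed

lemma F_strict_mono:
  assumes "0 \<le> x" "x < y" "y \<le> rstar"
  shows "F x < F y"
proof (cases "y = rstar")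
  case True
  then show ?thesis using F_less_max assms rstar by simp
next
  case False
  \<comment> \<open>The weight that writes \<open>y\<close> as a convex combination of
    \<open>x\<close> and \<open>rstar\<close>.\<close>
  define t where "t = (y - x) / (rstar - x)"
  have "0 < t" "t < 1"
    using assms False by (auto simp: t_def field_simps)
  moreover have "t * (rstar - x) = y - x"
    using assms by (simp add: t_def)
  then have "(1 - t) * x + t * rstar = y"
    by (simp add: algebra_simps)
  ultimately show ?thesis
    using F_less_between[of x t] assms rstar by simp
qed

lemma F_strict_antimono:
  assumes "rstar \<le> x" "x < y" "y \<le> 1"
  shows "F y < F x"
proof (cases "x = rstar")
  case True
  then show ?thesis using F_less_max assms rstar by simp
next
  case False
  \<comment> \<open>Here the inner point is \<open>x\<close>, between \<open>rstar\<close> and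
    \<open>y\<close>, so the chord starts at \<open>y\<close>.\<close>
  define t where "t = (y - x) / (y - rstar)"
  have "0 < t" "t < 1"
    using assms False by (auto simp: t_def field_simps)
  moreover have "t * (y - rstar) = y - x"
    using assms by (simp add: t_def)
  then have "(1 - t) * y + t * rstar = x"
    by (simp add: algebra_simps)
  ultimately show ?thesis
    using F_less_between[of y t] assms rstar by simp
qed

lemma F_eq_iff_left: "\<lbrakk>x \<in> {0..rstar}; y \<in> {0..rstar}\<rbrakk> \<Longrightarrow> F x = F y \<longleftrightarrow> x = y"
  using F_strict_mono[of x y] F_strict_mono[of y x] by (cases x y rule: linorder_cases) auto

lemma F_eq_iff_right: "\<lbrakk>x \<in> {rstar..1}; y \<in> {rstar..1}\<rbrakk> \<Longrightarrow> F x = F y \<longleftrightarrow> x = y"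
  using F_strict_antimono[of x y] F_strict_antimono[of y x]
  by (cases x y rule: linorder_cases) auto

lemma continuous_on_F: "continuous_on {0..1} F"
  using diagram DERIV_continuous
  unfolding fundamental_diagram_def continuous_on_eq_continuous_within by blast

section \<open>The inverse branches of the diagram and the involution \<open>tau\<close>\<close>

lemma rho_minus_F: "x \<in> {0..rstar} \<Longrightarrow> rho_minus F rstar (F x) = x"
  unfolding rho_minus_def by (rule the_equality) (auto simp: F_eq_iff_left)

lemma rho_plus_F: "x \<in> {rstar..1} \<Longrightarrow> rho_plus F rstar (F x) = x"
  unfolding rho_plus_def by (rule the_equality) (auto simp: F_eq_iff_right)

lemma left_preimage:
  assumes "C \<in> {0..F rstar}"
  obtains x where "x \<in> {0..rstar}" "F x = C"
proof -
  have "continuous_on {0..rstar} F"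
    using continuous_on_F by (rule continuous_on_subset) (use rstar in auto)
  then show ?thesis
    using IVT'[of F 0 C rstar] assms rstar F_end that by auto
qed

lemma right_preimage:
  assumes "C \<in> {0..F rstar}"
  obtains x where "x \<in> {rstar..1}" "F x = C"
proof -
  have "continuous_on {rstar..1} F"
    using continuous_on_F by (rule continuous_on_subset) (use rstar in auto)
  then show ?thesis
    using IVT2'[of F 1 C rstar] assms rstar F_end that by auto
qed

lemma rho_minus:
  assumes "C \<in> {0..F rstar}"
  shows "0 \<le> rho_minus F rstar C" "rho_minus F rstar C \<le> rstar" "F (rho_minus F rstar C) = C"
  using assms by (metis left_preimage rho_minus_F atLeastAtMost_iff)+

lemma rho_plus:
  assumes "C \<in> {0..F rstar}"
  shows "rstar \<le> rho_plus F rstar C" "rho_plus F rstar C \<le> 1" "F (rho_plus F rstar C) = C"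
  using assms by (metis right_preimage rho_plus_F atLeastAtMost_iff)+

lemma rho_minus_end: "rho_minus F rstar 0 = 0" "rho_minus F rstar (F rstar) = rstar"
  using rho_minus_F[of 0] rho_minus_F[of rstar] rstar F_end by auto

lemma rho_plus_end: "rho_plus F rstar 0 = 1" "rho_plus F rstar (F rstar) = rstar"
  using rho_plus_F[of 1] rho_plus_F[of rstar] rstar F_end by auto

lemma rho_minus_strict_mono:
  assumes "0 \<le> C" "C < D" "D \<le> F rstar"
  shows "rho_minus F rstar C < rho_minus F rstar D"
proof (rule ccontr)
  assume "\<not> ?thesis"
  then have "F (rho_minus F rstar D) \<le> F (rho_minus F rstar C)"
    using F_strict_mono[of "rho_minus F rstar D" "rho_minus F rstar C"]
      rho_minus[of C] rho_minus[of D] assms by force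
  then show False using assms rho_minus by simp
qed

lemma rho_minus_mono: "\<lbrakk>0 \<le> C; C \<le> D; D \<le> F rstar\<rbrakk> \<Longrightarrow> rho_minus F rstar C \<le> rho_minus F rstar D"
  using rho_minus_strict_mono[of C D] by (cases "C = D") auto

lemma rho_plus_strict_antimono:
  assumes "0 \<le> C" "C < D" "D \<le> F rstar"
  shows "rho_plus F rstar D < rho_plus F rstar C"
proof (rule ccontr)
  assume "\<not> ?thesis"
  then have "F (rho_plus F rstar D) \<le> F (rho_plus F rstar C)"
    using F_strict_antimono[of "rho_plus F rstar C" "rho_plus F rstar D"]
      rho_plus[of C] rho_plus[of D] assms by force
  then show False using assms rho_plus by simp
qed

lemma rho_plus_antimono: "\<lbrakk>0 \<le> C; C \<le> D; D \<le> F rstar\<rbrakk> \<Longrightarrow> rho_plus F rstar D \<le> rho_plus F rstar C"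
  using rho_plus_strict_antimono[of C D] by (cases "C = D") auto

text \<open>A second root of equal flux cannot lie on the branch of \<open>r\<close>, where
  \<open>F\<close> is injective, so it is the one on the other branch. In this form the half-Riemann
  condition becomes a comparison of fluxes.\<close>

lemma tau_right:
  assumes "rstar < r" "r \<le> 1"
  shows "tau F rstar r = rho_minus F rstar (F r)"
proof -
  have r: "F r \<in> {0..F rstar}" "F r < F rstar"
    using F_bounds[of r] F_less_max[of r] assms rstar by auto
  show ?thesis
    unfolding tau_def using assms
  proof (simp, intro the_equality)
    show "0 \<le> rho_minus F rstar (F r) \<and> rho_minus F rstar (F r) \<le> 1 \<and>
        rho_minus F rstar (F r) \<noteq> r \<and> F (rho_minus F rstar (F r)) = F r"
      using rho_minus[OF r(1)] assms rstar by auto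
    show "x = rho_minus F rstar (F r)" if "0 \<le> x \<and> x \<le> 1 \<and> x \<noteq> r \<and> F x = F r" for x
      using F_eq_iff_right[of x r] rho_minus_F[of x] that assms by force
  qed
qed

lemma tau_left:
  assumes "0 \<le> r" "r < rstar"
  shows "tau F rstar r = rho_plus F rstar (F r)"
proof -
  have r: "F r \<in> {0..F rstar}" "F r < F rstar"
    using F_bounds[of r] F_less_max[of r] assms rstar by auto
  show ?thesis
    unfolding tau_def using assms
  proof (simp, intro the_equality)
    show "0 \<le> rho_plus F rstar (F r) \<and> rho_plus F rstar (F r) \<le> 1 \<and>
        rho_plus F rstar (F r) \<noteq> r \<and> F (rho_plus F rstar (F r)) = F r"
      using rho_plus[OF r(1)] assms rstar by auto
    show "x = rho_plus F rstar (F r)" if "0 \<le> x \<and> x \<le> 1 \<and> x \<noteq> r \<and> F x = F r" for x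
      using F_eq_iff_left[of x r] rho_plus_F[of x] that assms by force
  qed
qed

section \<open>A single road: layer and half-Riemann conditions as flux constraints\<close>

lemma road_supply_bounds: "rB \<in> {0..1} \<Longrightarrow> 0 \<le> road_supply F rstar rB \<and> road_supply F rstar rB \<le> F rstar"
  using F_bounds[of rB] max_flux by (auto simp: road_supply_def)

lemma road_demand_bounds: "rB \<in> {0..1} \<Longrightarrow> 0 \<le> road_demand F rstar rB \<and> road_demand F rstar rB \<le> F rstar"
  using F_bounds[of rB] max_flux by (auto simp: road_demand_def)

lemma road_supply_right: "rB \<ge> rstar \<Longrightarrow> road_supply F rstar rB = F rB"
  by (auto simp: road_supply_def)

lemma road_demand_left: "rB \<le> rstar \<Longrightarrow> road_demand F rstar rB = F rB"
  by (auto simp: road_demand_def)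

text \<open>Eliminates \<open>rK\<close>. An unstable layer has
  \<open>rK = rho_minus F rstar C\<close>, admissible exactly when \<open>C \<le> s\<close>. For
  \<open>rB > rstar\<close>, a stable layer ends on the congested side, which forces
  \<open>rK = rB\<close> and hence \<open>C = s\<close>; for \<open>rB \<le> rstar\<close>, it is
  possible only at maximal flux. The last conjunct records that only a layer of zero flux admits
  density 1.\<close>

lemma outgoing_iff:
  assumes rB: "rB \<in> {0..1}" and C: "C \<in> {0..F rstar}" and r0: "r0 \<in> {0..1}"
  defines "s \<equiv> road_supply F rstar rB"
  shows "(\<exists>rK\<in>{0..1}. layer_outgoing F rstar C rK r0 \<and> half_riemann_outgoing F rstar rB rK) \<longleftrightarrow>
     C \<le> s \<and> rho_minus F rstar C \<le> r0 \<and> (C < s \<longrightarrow> r0 = rho_minus F rstar C) \<and>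
     (r0 = 1 \<longrightarrow> C = 0)" (is "?L \<longleftrightarrow> ?R")
proof (cases "rB \<le> rstar")
  case True
  then have s: "s = F rstar"
    by (simp add: s_def road_supply_def)
  \<comment> \<open>Below maximal flux every stable layer ends strictly above \<open>rstar\<close>,
    so only the unstable one remains.\<close>
  have U: "layer_outgoing F rstar C rK r0 \<longleftrightarrow>
      rK = rho_minus F rstar C \<and> r0 = rho_minus F rstar C"
    if "C < F rstar" "rK \<le> rstar" for rK
    using that rho_plus_strict_antimono[of C "F rstar"] C rstar
    by (auto simp: layer_outgoing_def rho_plus_end)
  show ?thesis
  proof (cases "C < F rstar")
    case below: True
    have "?L \<longleftrightarrow> r0 = rho_minus F rstar C"
      using True rho_minus[OF C] rstar U[OF below]
      by (auto simp: half_riemann_outgoing_def intro!: bexI[of _ "rho_minus F rstar C"])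
    then show ?thesis
      using below C rho_minus[OF C] rstar by (auto simp: s)
  next
    case False
    then have "C = F rstar" using C by simp
    then show ?thesis
      using True r0 rstar max_flux
      by (auto simp: s layer_outgoing_def half_riemann_outgoing_def rho_minus_end)
  qed
next
  case False
  then have s: "s = F rB" "tau F rstar rB = rho_minus F rstar s" "s < F rstar" "0 \<le> s"
    "rho_plus F rstar s = rB"
    using rB tau_right[of rB] F_less_max[of rB] F_bounds[of rB] rho_plus_F[of rB]
    by (auto simp: s_def road_supply_def)
  have half: "half_riemann_outgoing F rstar rB rK \<longleftrightarrow> 0 \<le> rK \<and> rK \<le> rho_minus F rstar s \<or> rK = rB" for rK
    using False s by (auto simp: half_riemann_outgoing_def)
  have s_le: "rho_minus F rstar s < rstar"
    using rho_minus_strict_mono[of s "F rstar"] s rho_minus_end by simp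
  show ?thesis
  proof
    assume ?L
    then obtain rK where lay: "layer_outgoing F rstar C rK r0"
      and rK: "0 \<le> rK \<and> rK \<le> rho_minus F rstar s \<or> rK = rB" by (auto simp: half)
    consider (U) "C < F rstar" "rK = rho_minus F rstar C" "r0 = rho_minus F rstar C"
      | (S) "0 < C" "C < F rstar" "rK = rho_plus F rstar C" "rho_minus F rstar C < r0" "r0 < 1"
      | (max) "rK = rstar"
      | (min) "C = 0" "rK = 1" "0 < r0"
      using lay by (auto simp: layer_outgoing_def)
    then show ?R
    proof cases
      case U
      then have "rK \<noteq> rB" using False rho_minus[OF C] by auto
      then have "\<not> s < C" using rho_minus_strict_mono[of s C] U rK s C by auto
      then show ?thesis using U rho_minus[OF C] rstar by auto
    next
      case S
      then have "rK = rB" using rK s_le rho_plus[OF C] by auto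
      then have "C = s" using S rho_plus[OF C] s by auto
      then show ?thesis using S by auto
    next
      case max
      \<comment> \<open>Contradictory: \<open>rstar\<close> lies strictly between the two admissible
        sets for \<open>rK\<close>.\<close>
      then show ?thesis using rK s_le False by auto
    next
      case min
      then have "rB = 1" using rK s_le rstar by auto
      then show ?thesis using min s F_end rho_minus_end by auto
    qed
  next
    assume ?R
    \<comment> \<open>Any \<open>r0\<close> other than \<open>rho_minus F rstar C\<close> forces
      saturation. Zero flux is split off because its stable layer has its own interval for
      \<open>r0\<close>, which includes 1.\<close>
    then consider (U) "r0 = rho_minus F rstar C" | (S) "C = s" "rho_minus F rstar C < r0" "0 < C" "r0 < 1"
      | (min) "C = 0" "s = 0" "0 < r0"
      using C r0 rho_minus_end by fastforce
    then show ?L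
    proof cases
      case U
      have "layer_outgoing F rstar C r0 r0"
        using U C \<open>?R\<close> s by (auto simp: layer_outgoing_def)
      moreover have "half_riemann_outgoing F rstar rB r0"
        using half U r0 rho_minus_mono[of C s] \<open>?R\<close> C s by auto
      ultimately show ?thesis using r0 by blast
    next
      case S
      then have "layer_outgoing F rstar C rB r0"
        using s by (auto simp: layer_outgoing_def)
      then show ?thesis using half rB by blast
    next
      case min
      then have "rB = 1" using s rho_plus_end by simp
      then have "layer_outgoing F rstar C rB r0"
        using min r0 by (auto simp: layer_outgoing_def)
      then show ?thesis using half rB by blast
    qed
  qed
qed

text \<open>Mirror image of \<open>outgoing_iff\<close>, with the branches exchanged and the order
  reversed. There is no end point condition, since the stable intervals for \<open>r0\<close>
  contain 0.\<close>

lemma incoming_iff: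
  assumes rB: "rB \<in> {0..1}" and C: "C \<in> {0..F rstar}" and r0: "r0 \<in> {0..1}"
  defines "d \<equiv> road_demand F rstar rB"
  shows "(\<exists>rK\<in>{0..1}. layer_incoming F rstar C rK r0 \<and> half_riemann_incoming F rstar rB rK) \<longleftrightarrow>
     C \<le> d \<and> r0 \<le> rho_plus F rstar C \<and> (C < d \<longrightarrow> r0 = rho_plus F rstar C)" (is "?L \<longleftrightarrow> ?R")
proof (cases "rB \<ge> rstar")
  case True
  then have d: "d = F rstar"
    by (simp add: d_def road_demand_def)
  have U: "layer_incoming F rstar C rK r0 \<longleftrightarrow>
      rK = rho_plus F rstar C \<and> r0 = rho_plus F rstar C"
    if "C < F rstar" "rK \<ge> rstar" for rK
    using that rho_minus_strict_mono[of C "F rstar"] C rstar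
    by (auto simp: layer_incoming_def rho_minus_end)
  show ?thesis
  proof (cases "C < F rstar")
    case below: True
    have "?L \<longleftrightarrow> r0 = rho_plus F rstar C"
      using True rho_plus[OF C] rstar U[OF below]
      by (auto simp: half_riemann_incoming_def intro!: bexI[of _ "rho_plus F rstar C"])
    then show ?thesis
      using below C by (auto simp: d)
  next
    case False
    then have "C = F rstar" using C by simp
    then show ?thesis
      using True r0 rstar max_flux
      by (auto simp: d layer_incoming_def half_riemann_incoming_def rho_plus_end)
  qed
next
  case False
  then have d: "d = F rB" "tau F rstar rB = rho_plus F rstar d" "d < F rstar" "0 \<le> d"
    "rho_minus F rstar d = rB"
    using rB tau_left[of rB] F_less_max[of rB] F_bounds[of rB] rho_minus_F[of rB]
    by (auto simp: d_def road_demand_def)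
  have half: "half_riemann_incoming F rstar rB rK \<longleftrightarrow> rK = rB \<or> rho_plus F rstar d \<le> rK \<and> rK \<le> 1" for rK
    using False d by (auto simp: half_riemann_incoming_def)
  have d_le: "rstar < rho_plus F rstar d"
    using rho_plus_strict_antimono[of d "F rstar"] d rho_plus_end by simp
  show ?thesis
  proof
    assume ?L
    then obtain rK where lay: "layer_incoming F rstar C rK r0"
      and rK: "rK = rB \<or> rho_plus F rstar d \<le> rK \<and> rK \<le> 1" by (auto simp: half)
    consider (U) "C < F rstar" "rK = rho_plus F rstar C" "r0 = rho_plus F rstar C"
      | (S) "0 < C" "C < F rstar" "rK = rho_minus F rstar C" "r0 < rho_plus F rstar C"
      | (max) "rK = rstar"
      | (min) "C = 0" "rK = 0" "r0 < 1"
      using lay by (auto simp: layer_incoming_def)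
    then show ?R
    proof cases
      case U
      then have "rK \<noteq> rB" using False rho_plus[OF C] by auto
      then have "\<not> d < C" using rho_plus_strict_antimono[of d C] U rK d C by auto
      then show ?thesis using U by auto
    next
      case S
      then have "rK = rB" using rK d_le rho_minus[OF C] by auto
      then have "C = d" using S rho_minus[OF C] d by auto
      then show ?thesis using S by auto
    next
      case max
      then show ?thesis using rK d_le False by auto
    next
      case min
      then have "rB = 0" using rK d_le rstar by auto
      then show ?thesis using min d F_end rho_plus_end by auto
    qed
  next
    assume ?R
    then consider (U) "r0 = rho_plus F rstar C" | (S) "C = d" "r0 < rho_plus F rstar C" "0 < C"
      | (min) "C = 0" "d = 0" "r0 < 1"
      using C r0 rho_plus_end by fastforce
    then show ?L
    proof cases
      case U
      have "layer_incoming F rstar C r0 r0"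
        using U C \<open>?R\<close> d by (auto simp: layer_incoming_def)
      moreover have "half_riemann_incoming F rstar rB r0"
        using half U r0 rho_plus_antimono[of C d] \<open>?R\<close> C d by auto
      ultimately show ?thesis using r0 by blast
    next
      case S
      then have "layer_incoming F rstar C rB r0"
        using d r0 by (auto simp: layer_incoming_def)
      then show ?thesis using half rB by blast
    next
      case min
      then have "rB = 0" using d rho_minus_end by simp
      then have "layer_incoming F rstar C rB r0"
        using min r0 by (auto simp: layer_incoming_def)
      then show ?thesis using half rB by blast
    qed
  qed
qed

section \<open>The junction: densities eliminated, fluxes determined\<close>

lemma matching_solution_iff:
  assumes rB: "\<forall>i\<in>{1,2,3}. rB i \<in> {0..1}"
  shows "(\<exists>rK. matching_solution F rstar rB C rK r0) \<longleftrightarrow>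
    (\<forall>i\<in>{1,2,3}. C i \<in> {0..F rstar} \<and> r0 i \<in> {0..1}) \<and>
    C 1 \<le> road_demand F rstar (rB 1) \<and> r0 1 \<le> rho_plus F rstar (C 1) \<and>
    (C 1 < road_demand F rstar (rB 1) \<longrightarrow> r0 1 = rho_plus F rstar (C 1)) \<and>
    (\<forall>i\<in>{2,3}. C i \<le> road_supply F rstar (rB i) \<and> rho_minus F rstar (C i) \<le> r0 i \<and>
      (C i < road_supply F rstar (rB i) \<longrightarrow> r0 i = rho_minus F rstar (C i)) \<and> (r0 i = 1 \<longrightarrow> C i = 0)) \<and>
    kinetic_coupling r0 C"
proof -
  \<comment> \<open>A single predicate indexed by the road, so that the choice of the function
    \<open>rK\<close> splits into independent choices on the three roads.\<close>
  define P where "P i rK \<longleftrightarrow> (if i = (1::nat)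
      then layer_incoming F rstar (C i) rK (r0 i) \<and> half_riemann_incoming F rstar (rB i) rK
      else layer_outgoing F rstar (C i) rK (r0 i) \<and> half_riemann_outgoing F rstar (rB i) rK)"
    for i rK
  have "(\<exists>rK. matching_solution F rstar rB C rK r0) \<longleftrightarrow>
    (\<forall>i\<in>{1,2,3}. C i \<in> {0..F rstar} \<and> r0 i \<in> {0..1}) \<and> kinetic_coupling r0 C \<and>
    (\<exists>rK. \<forall>i\<in>{1,2,3}. rK i \<in> {0..1} \<and> P i (rK i))"
    unfolding matching_solution_def P_def by auto
  also have "(\<exists>rK. \<forall>i\<in>{1,2,3}. rK i \<in> {0..1} \<and> P i (rK i)) \<longleftrightarrow>
      (\<forall>i\<in>{1,2,3}. \<exists>rK\<in>{0..1}. P i rK)"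
    by (subst Bex_def, rule bchoice_iff[symmetric])
  also have "(\<forall>i\<in>{1,2,3}. C i \<in> {0..F rstar} \<and> r0 i \<in> {0..1}) \<and> kinetic_coupling r0 C \<and> \<dots> \<longleftrightarrow>
    (\<forall>i\<in>{1,2,3}. C i \<in> {0..F rstar} \<and> r0 i \<in> {0..1}) \<and> kinetic_coupling r0 C \<and>
    (\<exists>rK\<in>{0..1}. P 1 rK) \<and> (\<forall>i\<in>{2,3}. \<exists>rK\<in>{0..1}. P i rK)"
    by simp
  also have "\<dots> \<longleftrightarrow> (\<forall>i\<in>{1,2,3}. C i \<in> {0..F rstar} \<and> r0 i \<in> {0..1}) \<and>
    C 1 \<le> road_demand F rstar (rB 1) \<and> r0 1 \<le> rho_plus F rstar (C 1) \<and>
    (C 1 < road_demand F rstar (rB 1) \<longrightarrow> r0 1 = rho_plus F rstar (C 1)) \<and>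
    (\<forall>i\<in>{2,3}. C i \<le> road_supply F rstar (rB i) \<and> rho_minus F rstar (C i) \<le> r0 i \<and>
      (C i < road_supply F rstar (rB i) \<longrightarrow> r0 i = rho_minus F rstar (C i)) \<and> (r0 i = 1 \<longrightarrow> C i = 0)) \<and>
    kinetic_coupling r0 C"
  \<comment> \<open>The congruence makes the ranges of \<open>C\<close> and \<open>r0\<close>
    available as premises of the single-road equivalences.\<close>
  proof (rule conj_cong[THEN trans])
    show "(\<forall>i\<in>{1,2,3}. C i \<in> {0..F rstar} \<and> r0 i \<in> {0..1}) = (\<forall>i\<in>{1,2,3}. C i \<in> {0..F rstar} \<and> r0 i \<in> {0..1})" ..
  qed (use rB in \<open>auto simp: P_def incoming_iff outgoing_iff\<close>)
  finally show ?thesis .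
qed

lemma matching_solution_fluxes:
  assumes rB: "\<forall>i\<in>{1,2,3}. rB i \<in> {0..1}"
    and sol: "matching_solution F rstar rB C rK r0"
  defines "d \<equiv> road_demand F rstar (rB 1)" and "s \<equiv> \<lambda>i. road_supply F rstar (rB i)"
  shows "C 1 = C 2 + C 3" "C 1 \<le> d" "C 2 \<le> s 2" "C 3 \<le> s 3"
    "C 1 < d \<Longrightarrow> C 2 = s 2 \<and> C 3 = s 3" "C 2 < C 3 \<Longrightarrow> C 2 = s 2" "C 3 < C 2 \<Longrightarrow> C 3 = s 3"
proof -
  have dens: "0 \<le> C 1" "0 \<le> C 2" "0 \<le> C 3" "C 1 \<le> F rstar" "C 2 \<le> F rstar" "C 3 \<le> F rstar"
      "C 1 \<le> d" "C 1 < d \<Longrightarrow> r0 1 = rho_plus F rstar (C 1)"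
      "C 2 \<le> s 2" "rho_minus F rstar (C 2) \<le> r0 2" "C 2 < s 2 \<Longrightarrow> r0 2 = rho_minus F rstar (C 2)"
      "C 3 \<le> s 3" "rho_minus F rstar (C 3) \<le> r0 3" "C 3 < s 3 \<Longrightarrow> r0 3 = rho_minus F rstar (C 3)"
    and coupling: "kinetic_coupling r0 C"
    using matching_solution_iff[OF rB, of C r0] sol by (auto simp: d_def s_def)
  then show "C 1 = C 2 + C 3" "C 1 \<le> d" "C 2 \<le> s 2" "C 3 \<le> s 3"
    by (auto simp: kinetic_coupling_def)
  have s: "0 \<le> s 2" "0 \<le> s 3"
    using rB road_supply_bounds by (auto simp: s_def)
  have d: "d \<le> F rstar"
    using rB road_demand_bounds by (auto simp: d_def)
  have low: "rho_minus F rstar (C 2) \<le> rstar" "rho_minus F rstar (C 3) \<le> rstar"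
    using rho_minus dens by auto
  show "C 2 = s 2 \<and> C 3 = s 3" if "C 1 < d"
  proof -
    \<comment> \<open>This excludes coupling (II), where
      \<open>r0 1 = C 1 \<le> F rstar \<le> rstar\<close>. In (I), (III) and (IV) both outgoing
      densities are at least \<open>r0 1\<close>, hence above \<open>rho_minus\<close> of their
      fluxes, which only saturated roads permit.\<close>
    have "rstar < r0 1"
      using rho_plus_strict_antimono[of "C 1" "F rstar"] rho_plus_end dens that d by simp
    then show ?thesis
      using coupling dens low s max_flux by (fastforce simp: kinetic_coupling_def)
  qed
  \<comment> \<open>Coupling (IV) would need \<open>C 3 = 0\<close>. In the others \<open>r0 2 \<ge>
    r0 3 \<ge> rho_minus F rstar (C 3) > rho_minus F rstar (C 2)\<close>, so road 2 is
    saturated.\<close>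
  show "C 2 = s 2" if "C 2 < C 3"
    using rho_minus_strict_mono[of "C 2" "C 3"] that coupling dens s
    by (fastforce simp: kinetic_coupling_def)
  show "C 3 = s 3" if "C 3 < C 2"
    using rho_minus_strict_mono[of "C 3" "C 2"] that coupling dens s
    by (fastforce simp: kinetic_coupling_def)
qed

text \<open>Linear arithmetic on the preceding constraints. The four regimes cover all values of
  \<open>d\<close>, \<open>s2\<close> and \<open>s3\<close>.\<close>

lemma matching_solution_flux_split:
  assumes rB: "\<forall>i\<in>{1,2,3}. rB i \<in> {0..1}"
    and sol: "matching_solution F rstar rB C rK r0"
  defines "d \<equiv> road_demand F rstar (rB 1)"
    and "s2 \<equiv> road_supply F rstar (rB 2)" and "s3 \<equiv> road_supply F rstar (rB 3)"
  shows "s2 + s3 \<le> d \<Longrightarrow> C 1 = s2 + s3 \<and> C 2 = s2 \<and> C 3 = s3"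
    and "d \<le> 2 * s2 \<Longrightarrow> d \<le> 2 * s3 \<Longrightarrow> C 1 = d \<and> C 2 = d / 2 \<and> C 3 = d / 2"
    and "d \<le> s2 + s3 \<Longrightarrow> 2 * s3 \<le> d \<Longrightarrow> C 1 = d \<and> C 2 = d - s3 \<and> C 3 = s3"
    and "d \<le> s2 + s3 \<Longrightarrow> 2 * s2 \<le> d \<Longrightarrow> C 1 = d \<and> C 2 = s2 \<and> C 3 = d - s2"
proof -
  note flux = matching_solution_fluxes[OF rB sol, folded d_def s2_def s3_def]
  have bound: "C 1 = C 2 + C 3" "C 1 \<le> d" "C 2 \<le> s2" "C 3 \<le> s3"
    by (fact flux)+
  have saturated: "C 1 = d \<or> C 2 = s2 \<and> C 3 = s3"
    using flux by fastforce
  have fair: "C 2 = C 3 \<or> C 2 < C 3 \<and> C 2 = s2 \<or> C 3 < C 2 \<and> C 3 = s3"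
    using flux by fastforce
  show "C 1 = s2 + s3 \<and> C 2 = s2 \<and> C 3 = s3" if "s2 + s3 \<le> d"
    using bound saturated that by auto
  \<comment> \<open>If both outgoing roads are saturated, \<open>C 1 = s2 + s3 \<ge> d\<close>, and
    \<open>C 1 \<le> d\<close> gives equality again.\<close>
  have C1: "C 1 = d" if "d \<le> s2 + s3"
    using bound saturated that by auto
  show "C 1 = d \<and> C 2 = d / 2 \<and> C 3 = d / 2" if "d \<le> 2 * s2" "d \<le> 2 * s3"
    using bound fair C1 that by auto
  show "C 1 = d \<and> C 2 = d - s3 \<and> C 3 = s3" if "d \<le> s2 + s3" "2 * s3 \<le> d"
    using bound fair C1 that by auto
  show "C 1 = d \<and> C 2 = s2 \<and> C 3 = d - s2" if "d \<le> s2 + s3" "2 * s2 \<le> d"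
    using bound fair C1 that by auto
qed

section \<open>Existence of a solution\<close>

lemma matching_solution_exists:
  assumes rB: "\<forall>i\<in>{1,2,3}. rB i \<in> {0..1}"
  shows "\<exists>C rK r0. matching_solution F rstar rB C rK r0"
proof -
  define d s2 s3 where "d = road_demand F rstar (rB 1)"
    and "s2 = road_supply F rstar (rB 2)" and "s3 = road_supply F rstar (rB 3)"
  have bounds: "0 \<le> d" "d \<le> F rstar" "0 \<le> s2" "s2 \<le> F rstar" "0 \<le> s3" "s3 \<le> F rstar"
    using rB road_demand_bounds road_supply_bounds by (auto simp: d_def s2_def s3_def)
  \<comment> \<open>The solutions constructed have one common density \<open>r\<close> on the
    outgoing roads; the last premise offers coupling (I) or (II).\<close>
  have solve: ?thesis
    if "0 \<le> C2" "0 \<le> C3" "C2 \<le> s2" "C3 \<le> s3" "C1 = C2 + C3" "C1 \<le> d" "0 \<le> r1"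
      "r1 \<le> rho_plus F rstar C1" "C1 < d \<Longrightarrow> r1 = rho_plus F rstar C1"
      "rho_minus F rstar C2 \<le> r" "C2 < s2 \<Longrightarrow> r = rho_minus F rstar C2"
      "rho_minus F rstar C3 \<le> r" "C3 < s3 \<Longrightarrow> r = rho_minus F rstar C3"
      "0 \<le> r" "r \<le> 1" "r = 1 \<Longrightarrow> C1 = 0" "r1 = r \<and> C1 \<le> r \<or> r \<le> C1 \<and> r1 = C1"
    for C1 C2 C3 r1 r
  proof -
    let ?C = "\<lambda>i::nat. if i = 1 then C1 else if i = 2 then C2 else C3"
    let ?r = "\<lambda>i::nat. if i = 1 then r1 else r"
    have "\<exists>rK. matching_solution F rstar rB ?C rK ?r"
      unfolding matching_solution_iff[OF rB]
      using that bounds rho_plus[of C1]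
      by (auto simp: kinetic_coupling_def d_def s2_def s3_def)
    then show ?thesis by blast
  qed
  show ?thesis
  proof (cases "s2 + s3 \<le> d")
    case True
    \<comment> \<open>Both outgoing roads are saturated, so all three roads can take this density,
      with coupling (I). It equals 1 only when the flux is zero.\<close>
    define r where "r = rho_plus F rstar (s2 + s3)"
    have r: "rstar \<le> r" "r \<le> 1" "F r = s2 + s3"
      using rho_plus[of "s2 + s3"] True bounds by (auto simp: r_def)
    show ?thesis
      by (rule solve[of s2 s3 "s2 + s3" r r])
        (use True bounds r rho_minus[of s2] rho_minus[of s3] rstar F_end max_flux
         in \<open>auto simp flip: r_def\<close>)
  next
    case False
    \<comment> \<open>The demand is halved unless a supply is below \<open>d / 2\<close>; as
      \<open>d < s2 + s3\<close>, this happens on at most one road.\<close>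
    define C2 where "C2 = (if s2 < d / 2 then s2 else if s3 < d / 2 then d - s3 else d / 2)"
    define C3 where "C3 = d - C2"
    \<comment> \<open>An unsaturated road carries the larger flux and needs exactly this density; a
      saturated one only needs \<open>r\<close> to dominate its own
      \<open>rho_minus\<close>.\<close>
    define r where "r = rho_minus F rstar (max C2 C3)"
    have C: "0 \<le> C2" "C2 \<le> s2" "0 \<le> C3" "C3 \<le> s3" "C2 + C3 = d" "C2 < C3 \<Longrightarrow> C2 = s2" "C3 < C2 \<Longrightarrow> C3 = s3"
      using False bounds by (auto simp: C2_def C3_def split: if_splits)
    have r: "rho_minus F rstar C2 \<le> r" "rho_minus F rstar C3 \<le> r"
      using C bounds by (auto simp: r_def intro!: rho_minus_mono)
    have r': "0 \<le> r" "r \<le> rstar"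
      using rho_minus[of "max C2 C3"] C bounds by (auto simp: r_def max_def)
    have eq: "C2 < s2 \<Longrightarrow> r = rho_minus F rstar C2" "C3 < s3 \<Longrightarrow> r = rho_minus F rstar C3"
      using C by (fastforce simp: r_def max_def)+
    show ?thesis
      \<comment> \<open>The incoming density \<open>max r d\<close> gives coupling (I) if
        \<open>d \<le> r\<close> and (II) otherwise. Both \<open>r\<close> and \<open>d\<close> are
        at most \<open>rstar\<close>, hence at most \<open>rho_plus F rstar d\<close>, which
        suffices as the demand is attained.\<close>
      by (rule solve[of C2 C3 d "max r d" r])
        (use C r r' eq bounds rstar rho_plus[of d] max_flux in \<open>auto simp: max_def\<close>)
  qed
qed

end

section \<open>The table of the eight cases\<close>

theorem theorem5p1:
  fixes F :: "real \<Rightarrow> real" and rstar \<sigma> :: real and rB :: "nat \<Rightarrow> real"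
  assumes "fundamental_diagram F rstar"
    and "\<sigma> = F rstar"
    and "rB 1 \<in> {0..1}" and "rB 2 \<in> {0..1}" and "rB 3 \<in> {0..1}"
  shows "(\<exists>C rK r0. matching_solution F rstar rB C rK r0) \<and>
    (\<forall>C rK r0. matching_solution F rstar rB C rK r0 \<longrightarrow>
      C 1 = C 2 + C 3 \<and>
      (rB 1 \<ge> rstar \<and> rB 2 \<le> rstar \<and> rB 3 \<le> rstar \<longrightarrow>
         C 1 = \<sigma> \<and> C 2 = \<sigma> / 2 \<and> C 3 = \<sigma> / 2) \<and>
      (rB 1 \<ge> rstar \<and> rB 2 \<le> rstar \<and> rB 3 \<ge> rstar \<longrightarrow>
         (2 * F (rB 3) \<le> \<sigma> \<longrightarrow> C 1 = \<sigma> \<and> C 3 = F (rB 3)) \<and>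
         (2 * F (rB 3) \<ge> \<sigma> \<longrightarrow> C 1 = \<sigma> \<and> C 2 = \<sigma> / 2 \<and> C 3 = \<sigma> / 2)) \<and>
      (rB 1 \<ge> rstar \<and> rB 2 \<ge> rstar \<and> rB 3 \<le> rstar \<longrightarrow>
         (2 * F (rB 2) \<ge> \<sigma> \<longrightarrow> C 1 = \<sigma> \<and> C 2 = \<sigma> / 2 \<and> C 3 = \<sigma> / 2) \<and>
         (2 * F (rB 2) \<le> \<sigma> \<longrightarrow> C 1 = \<sigma> \<and> C 2 = F (rB 2))) \<and>
      (rB 1 \<le> rstar \<and> rB 2 \<le> rstar \<and> rB 3 \<le> rstar \<longrightarrow>
         C 1 = F (rB 1) \<and> C 2 = F (rB 1) / 2 \<and> C 3 = F (rB 1) / 2) \<and>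
      (rB 1 \<ge> rstar \<and> rB 2 \<ge> rstar \<and> rB 3 \<ge> rstar \<longrightarrow>
         (F (rB 2) + F (rB 3) \<le> \<sigma> \<longrightarrow> C 2 = F (rB 2) \<and> C 3 = F (rB 3)) \<and>
         (F (rB 2) \<ge> \<sigma> / 2 \<and> F (rB 3) \<ge> \<sigma> / 2 \<longrightarrow> C 1 = \<sigma> \<and> C 2 = \<sigma> / 2 \<and> C 3 = \<sigma> / 2) \<and>
         (F (rB 2) + F (rB 3) \<ge> \<sigma> \<and> F (rB 3) \<le> \<sigma> / 2 \<longrightarrow> C 1 = \<sigma> \<and> C 2 = \<sigma> - F (rB 3) \<and> C 3 = F (rB 3)) \<and>
         (F (rB 2) + F (rB 3) \<ge> \<sigma> \<and> F (rB 2) \<le> \<sigma> / 2 \<longrightarrow> C 1 = \<sigma> \<and> C 2 = F (rB 2) \<and> C 3 = \<sigma> - F (rB 2))) \<and>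
      (rB 1 \<le> rstar \<and> rB 2 \<le> rstar \<and> rB 3 \<ge> rstar \<longrightarrow>
         (F (rB 1) \<le> 2 * F (rB 3) \<longrightarrow> C 1 = F (rB 1) \<and> C 2 = F (rB 1) / 2 \<and> C 3 = F (rB 1) / 2) \<and>
         (2 * F (rB 3) \<le> F (rB 1) \<longrightarrow> C 1 = F (rB 1) \<and> C 3 = F (rB 3) \<and> C 2 = F (rB 1) - F (rB 3))) \<and>
      (rB 1 \<le> rstar \<and> rB 2 \<ge> rstar \<and> rB 3 \<le> rstar \<longrightarrow>
         (F (rB 1) \<le> 2 * F (rB 2) \<longrightarrow> C 1 = F (rB 1) \<and> C 2 = F (rB 1) / 2 \<and> C 3 = F (rB 1) / 2) \<and>
         (2 * F (rB 2) \<le> F (rB 1) \<longrightarrow> C 1 = F (rB 1) \<and> C 2 = F (rB 2) \<and> C 3 = F (rB 1) - F (rB 2))) \<and>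
      (rB 1 \<le> rstar \<and> rB 2 \<ge> rstar \<and> rB 3 \<ge> rstar \<longrightarrow>
         (F (rB 2) + F (rB 3) \<le> F (rB 1) \<longrightarrow> C 1 = F (rB 2) + F (rB 3) \<and> C 2 = F (rB 2) \<and> C 3 = F (rB 3)) \<and>
         (F (rB 1) / 2 \<le> min (F (rB 2)) (F (rB 3)) \<longrightarrow> C 1 = F (rB 1) \<and> C 2 = F (rB 1) / 2 \<and> C 3 = F (rB 1) / 2) \<and>
         (F (rB 2) + F (rB 3) \<ge> F (rB 1) \<and> 2 * F (rB 3) \<le> F (rB 1) \<longrightarrow> C 1 = F (rB 1) \<and> C 2 = F (rB 1) - F (rB 3) \<and> C 3 = F (rB 3)) \<and>
         (F (rB 2) + F (rB 3) \<ge> F (rB 1) \<and> 2 * F (rB 2) \<le> F (rB 1) \<longrightarrow> C 1 = F (rB 1) \<and> C 2 = F (rB 2) \<and> C 3 = F (rB 1) - F (rB 2))))"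
proof -
  interpret diagram F rstar by unfold_locales fact
  have rB: "\<forall>i\<in>{1,2,3}. rB i \<in> {0..1}" using assms by simp
  have bounds: "0 < \<sigma>" "F (rB 1) \<le> \<sigma>" "F (rB 2) \<le> \<sigma>" "F (rB 3) \<le> \<sigma>"
    "0 \<le> F (rB 1)" "0 \<le> F (rB 2)" "0 \<le> F (rB 3)"
    using max_flux F_bounds assms by auto
  have max_bound: "rB 1 \<ge> rstar \<Longrightarrow> road_demand F rstar (rB 1) = \<sigma>"
    "rB 2 \<le> rstar \<Longrightarrow> road_supply F rstar (rB 2) = \<sigma>"
    "rB 3 \<le> rstar \<Longrightarrow> road_supply F rstar (rB 3) = \<sigma>"
    using assms by (auto simp: road_demand_def road_supply_def)
  note bound = max_bound road_demand_left[of "rB 1"] road_supply_right[of "rB 2"] road_supply_right[of "rB 3"]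
  show ?thesis
  proof (rule conjI[OF matching_solution_exists[OF rB]], intro allI impI, goal_cases)
    case sol: (1 C rK r0)
    note split = matching_solution_flux_split[OF rB sol]
    show ?case
      \<comment> \<open>In each case the signs of \<open>rB i - rstar\<close> turn demand and
        supplies into \<open>\<sigma>\<close> or \<open>F (rB i)\<close>, and the four regimes of
        the split finish by linear arithmetic. The bounds provide comparisons implicit in the table,
        such as \<open>\<sigma> \<le> \<sigma> + F (rB 3)\<close>.\<close>
      by (rule conjI[OF matching_solution_fluxes(1)[OF rB sol]], intro conjI; rule impI; elim conjE;
          insert split bounds; simp only: bound; linarith)
  qed
qed

end
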